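(* Let $\mathbb{K}$ be an algebraically closed field of characteristic $0$ or of prime characteristic $p\ge 7$, and let $m\ge 5$ be an integer, with $m\le p-1$ if $\mathbb{K}$ has characteristic $p$. Then every solution $(x_1,\ldots,x_m)\in\mathbb{K}^m$ of the system $$X_1^k+X_2^k+\cdots+X_m^k=0,\qquad k=1,2,\ldots,m-2,$$ also satisfies the equations $$X_1^{k}+X_2^{k}+\cdots+X_m^{k}=0,\qquad k=m+2,m+3,\ldots,2m-3 .$$ *)

theory Defs
  imports "HOL-Computational_Algebra.Computational_Algebra"
begin

end

theory Submission
  imports Defs
begin

text \<open>Let \<open>P = \<Prod>\<^sub>i (X - x\<^sub>i)\<close> and let \<open>p\<^sub>k\<close> be the \<open>k\<close>-th power sum. Comparing coefficients in
  \<open>P' = \<Sum>\<^sub>i P / (X - x\<^sub>i)\<close> gives Newton's identities. Since \<open>1, \<dots>, m - 2\<close> are invertible, the vanishing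
  of \<open>p\<^sub>1, \<dots>, p\<^sub>m\<^sub>-\<^sub>2\<close> forces \<open>P = X\<^sup>m + a X + b\<close>. Hence
  \<open>p\<^sub>k = - a p\<^sub>k\<^sub>-\<^sub>m\<^sub>+\<^sub>1 - b p\<^sub>k\<^sub>-\<^sub>m\<close> for \<open>k \<ge> m\<close>, and for \<open>m + 2 \<le> k \<le> 2 m - 3\<close> both
  power sums on the right have index between \<open>1\<close> and \<open>m - 2\<close>.\<close>

text \<open>Synthetic division: comparing coefficients expresses \<open>coeff q j\<close> as
  \<open>coeff p (Suc j) + c * coeff q (Suc j)\<close>; unrolling this ends once the index passes
  the degree of \<open>q\<close>.\<close>

lemma coeff_linear_quotient:
  fixes p q :: "'a :: comm_ring_1 poly"
  assumes "p = [:-c, 1:] * q" and "degree q \<le> j + d"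
  shows "coeff q j = (\<Sum>t\<le>d. coeff p (Suc (j + t)) * c ^ t)"
  using assms(2)
proof (induction d arbitrary: j)
  case 0
  then show ?case by (simp add: assms(1) coeff_eq_0)
next
  case (Suc d)
  have "coeff q j = coeff p (Suc j) + c * coeff q (Suc j)"
    by (simp add: assms(1))
  also have "coeff q (Suc j) = (\<Sum>t\<le>d. coeff p (Suc (Suc j + t)) * c ^ t)"
    using Suc by simp
  finally show ?case
    by (simp add: sum.atMost_Suc_shift sum_distrib_left mult_ac del: sum.atMost_Suc)
qed

lemma newton_identity:
  fixes x :: "'b \<Rightarrow> 'a :: idom"
  assumes "finite A" and P: "P = (\<Prod>i\<in>A. [:- x i, 1:])"
  shows "of_nat (Suc j) * coeff P (Suc j) =
    (\<Sum>t\<le>card A. coeff P (Suc (j + t)) * (\<Sum>i\<in>A. x i ^ t))"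
proof -
  define Q where "Q i = (\<Prod>k\<in>A - {i}. [:- x k, 1:])" for i
  have "coeff (Q i) j = (\<Sum>t\<le>card A. coeff P (Suc (j + t)) * x i ^ t)" if "i \<in> A" for i
  proof (rule coeff_linear_quotient)
    show "P = [:- x i, 1:] * Q i"
      unfolding P Q_def using prod.remove[OF assms(1) that] .
    have "degree (Q i) \<le> (\<Sum>k\<in>A - {i}. degree [:- x k, 1:])"
      unfolding Q_def by (intro degree_prod_sum_le[unfolded comp_def]) (use assms(1) in auto)
    \<comment> \<open>A loose bound suffices and gives every \<open>i\<close> and \<open>j\<close>
      the same range of \<open>t\<close>; the surplus coefficients of \<open>P\<close>
      vanish.\<close>
    then show "degree (Q i) \<le> j + card A"
      using card_Diff1_le[of A i] by simp
  qed
  moreover have "pderiv P = (\<Sum>i\<in>A. Q i)"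
    by (simp add: P pderiv_prod Q_def pderiv_pCons)
  then have "of_nat (Suc j) * coeff P (Suc j) = (\<Sum>i\<in>A. coeff (Q i) j)"
    by (metis coeff_pderiv coeff_sum)
  ultimately have "of_nat (Suc j) * coeff P (Suc j) =
      (\<Sum>i\<in>A. \<Sum>t\<le>card A. coeff P (Suc (j + t)) * x i ^ t)"
    by simp
  then show ?thesis
    by (subst (asm) sum.swap) (simp add: sum_distrib_left)
qed

lemma coeff_eq_0_if_power_sums_eq_0:
  fixes x :: "'b \<Rightarrow> 'a :: idom"
  assumes "finite A" and P: "P = (\<Prod>i\<in>A. [:- x i, 1:])"
    and power_sums: "\<And>k. 1 \<le> k \<Longrightarrow> k + 2 \<le> card A \<Longrightarrow> (\<Sum>i\<in>A. x i ^ k) = 0"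
    and char: "\<And>k. 1 \<le> k \<Longrightarrow> k + 2 \<le> card A \<Longrightarrow> (of_nat k :: 'a) \<noteq> 0"
    and l: "2 \<le> l" "l < card A"
  shows "coeff P l = 0"
proof -
  have deg: "degree P = card A"
    by (simp add: P degree_prod_eq_sum_degree)
  obtain j where j: "l = Suc j" "1 \<le> j"
    using l by (cases l) auto
  have "coeff P (Suc (j + t)) * (\<Sum>i\<in>A. x i ^ t) = 0" if "t \<noteq> 0" for t
  proof (cases "t + 2 \<le> card A")
    case True
    then show ?thesis using power_sums[of t] that by simp
  next
    \<comment> \<open>Now \<open>t\<close> is at least \<open>card A - 1\<close>, so
      \<open>1 \<le> j\<close> pushes the index beyond the degree of \<open>P\<close>.\<close>
    case False
    then have "coeff P (Suc (j + t)) = 0"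
      using j deg by (intro coeff_eq_0) simp
    then show ?thesis by simp
  qed
  then have "(\<Sum>t\<le>card A. coeff P (Suc (j + t)) * (\<Sum>i\<in>A. x i ^ t)) =
      (\<Sum>t\<in>{0}. coeff P (Suc (j + t)) * (\<Sum>i\<in>A. x i ^ t))"
    by (intro sum.mono_neutral_right) auto
  \<comment> \<open>The surviving power sum, at \<open>t = 0\<close>, counts \<open>A\<close>, since
    \<open>0 ^ 0 = 1\<close>.\<close>
  then have "of_nat l * coeff P l = of_nat (card A) * coeff P l"
    using newton_identity[OF assms(1) P, of j] j by (simp add: mult.commute)
  then have "of_nat (card A - l) * coeff P l = 0"
    using l by (simp only: of_nat_diff[OF less_imp_le] left_diff_distrib) simp
  \<comment> \<open>\<open>card A - l\<close> lies between \<open>1\<close> and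
    \<open>card A - 2\<close>, so it is nonzero by \<open>char\<close>.\<close>
  then show ?thesis
    using char[of "card A - l"] l by simp
qed

text \<open>Each \<open>x i\<close> is a root of \<open>P\<close>; weight the equation at
  \<open>x i\<close> by \<open>x i ^ r\<close> and sum over \<open>A\<close>.\<close>

lemma power_sum_recurrence:
  fixes x :: "'b \<Rightarrow> 'a :: idom"
  assumes "finite A" and P: "P = (\<Prod>i\<in>A. [:- x i, 1:])"
  shows "(\<Sum>l\<le>card A. coeff P l * (\<Sum>i\<in>A. x i ^ (r + l))) = 0"
proof -
  have deg: "degree P = card A"
    by (simp add: P degree_prod_eq_sum_degree)
  have "poly P (x i) = 0" if "i \<in> A" for i
    using assms(1) that by (auto simp: P poly_prod)
  then have "0 = (\<Sum>i\<in>A. x i ^ r * poly P (x i))"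
    by simp
  also have "\<dots> = (\<Sum>i\<in>A. \<Sum>l\<le>card A. coeff P l * x i ^ (r + l))"
    by (simp add: poly_altdef deg sum_distrib_left power_add mult_ac)
  also have "\<dots> = (\<Sum>l\<le>card A. coeff P l * (\<Sum>i\<in>A. x i ^ (r + l)))"
    by (subst sum.swap) (simp add: sum_distrib_left)
  finally show ?thesis by simp
qed

theorem proposition5p7:
  fixes m :: nat and x :: "nat \<Rightarrow> 'a :: alg_closed_field"
  assumes char: "CHAR('a) = 0 \<or> (prime CHAR('a) \<and> CHAR('a) \<ge> 7 \<and> m \<le> CHAR('a) - 1)"
    and m: "m \<ge> 5"
    and sol: "\<forall>k\<in>{1..m-2}. (\<Sum>i=1..m. x i ^ k) = 0"
  shows "\<forall>k\<in>{m+2..2*m-3}. (\<Sum>i=1..m. x i ^ k) = 0"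
proof
  fix k assume k: "k \<in> {m+2..2*m-3}"
  define P where "P = (\<Prod>i=1..m. [:- x i, 1:])"
  have power_sums: "(\<Sum>i=1..m. x i ^ n) = 0" if "1 \<le> n" "n + 2 \<le> m" for n
    using sol that by simp
  \<comment> \<open>In characteristic \<open>p\<close>, \<open>0 < n < m < p\<close> excludes
    divisibility by \<open>p\<close>.\<close>
  have unit: "(of_nat n :: 'a) \<noteq> 0" if "1 \<le> n" "n + 2 \<le> m" for n
    using char that by (auto simp: of_nat_eq_0_iff_char_dvd dest: dvd_imp_le)
  have coeff: "coeff P l = 0" if "2 \<le> l" "l < m" for l
    by (rule coeff_eq_0_if_power_sums_eq_0[of "{1..m}" P x])
      (use P_def power_sums unit that in auto)
  have "degree P = m"
    by (simp add: P_def degree_prod_eq_sum_degree)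
  moreover have "lead_coeff P = 1"
    by (simp add: P_def lead_coeff_prod)
  ultimately have lead: "coeff P m = 1" by simp
  have "coeff P l * (\<Sum>i=1..m. x i ^ (k - m + l)) = 0" if "l < m" for l
  proof (cases "2 \<le> l")
    case True
    then show ?thesis using coeff that by simp
  next
    \<comment> \<open>For \<open>l\<close> equal to 0 or 1, \<open>2 \<le> k - m \<le> m - 3\<close>
      keeps the exponent between 2 and \<open>m - 2\<close>.\<close>
    case False
    then have "(\<Sum>i=1..m. x i ^ (k - m + l)) = 0"
      using k by (intro power_sums) auto
    then show ?thesis by simp
  qed
  then have "(\<Sum>l\<le>m. coeff P l * (\<Sum>i=1..m. x i ^ (k - m + l))) =
      (\<Sum>l\<in>{m}. coeff P l * (\<Sum>i=1..m. x i ^ (k - m + l)))"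
    by (intro sum.mono_neutral_right) auto
  then show "(\<Sum>i=1..m. x i ^ k) = 0"
    using power_sum_recurrence[OF _ P_def, of "k - m"] lead k by simp
qed

end
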